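(* Let $f(x)$ be a polynomial with rational coefficients, let $n\ge 1$, and let $M$ be the $n\times (\deg f+n)$ matrix with entries $$M_{i,j}=\mathrm{CT}_x\,\frac{f(x)(1+x)^{i-1}}{x^{j-1}},\qquad 1\le i\le n,\ 1\le j\le \deg f+n.$$ Then the sum of all $n\times n$ minors of $M$ equals $$\det \left( \mathrm{CT}_{x}\, (x^{i+j-1}+x^{i-j})f(x)f(x^{-1}) \right)_{1\le i,j \le k}\quad\text{if } n=2k,$$ and equals $$f(1)\det \left( \mathrm{CT}_{x}\, (x^{i-j}-x^{i+j})f(x)f(x^{-1}) \right)_{1\le i,j \le k}\quad\text{if } n=2k+1.$$
   Context: $\mathrm{CT}_x$ of a Laurent polynomial in the single variable $x$ is its coefficient of $x^0$; thus $M_{i,j}$ is the coefficient of $x^{j-1}$ in $f(x)(1+x)^{i-1}$. An $n\times n$ minor of $M$ is the determinant of the submatrix formed by all $n$ rows and a choice of $n$ columns, kept in increasing order; the sum is over all such choices. An empty determinant equals $1$. *)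

theory Defs
  imports
    "HOL-Computational_Algebra.Formal_Laurent_Series"
    "Jordan_Normal_Form.Determinant"
    "Jordan_Normal_Form.DL_Submatrix"
begin

text \<open>Laurent polynomials in \<open>x\<close> over the rationals are taken inside the field
  \<^typ>\<open>rat fls\<close> of formal Laurent series, with \<open>x\<close> being \<^const>\<open>fls_X\<close>.\<close>

definition CT :: "'a::zero fls \<Rightarrow> 'a" where
  "CT g = fls_nth g 0"

definition fls_eval :: "'a::field poly \<Rightarrow> 'a fls \<Rightarrow> 'a fls" where
  "fls_eval f g = poly (map_poly fls_const f) g"

text \<open>\<^const>\<open>mat\<close> indexes from 0; the formulas below keep the usual 1-based indices, which the
  following matrix constructor shifts.\<close>

definition mat1 :: "nat \<Rightarrow> nat \<Rightarrow> (nat \<Rightarrow> nat \<Rightarrow> 'a) \<Rightarrow> 'a mat" where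
  "mat1 r c a = mat r c (\<lambda>(i, j). a (i + 1) (j + 1))"

definition M_mat :: "nat \<Rightarrow> 'a::field poly \<Rightarrow> 'a mat" where
  "M_mat n f = mat1 n (degree f + n)
     (\<lambda>i j. CT (fls_eval f fls_X * (1 + fls_X) ^ (i - 1) / fls_X ^ (j - 1)))"

text \<open>\<^const>\<open>submatrix\<close> keeps the selected rows and columns in increasing order.\<close>

definition sum_maximal_minors :: "'a::comm_ring_1 mat \<Rightarrow> 'a" where
  "sum_maximal_minors A =
     (\<Sum>J | J \<subseteq> {..<dim_col A} \<and> card J = dim_row A. det (submatrix A {..<dim_row A} J))"

lemma fls_eval_X: "fls_eval f fls_X = fps_to_fls (fps_of_poly f)"
proof (induction f)
  case (pCons a f)
  then show ?case
    by (simp add: fls_eval_def map_poly_pCons fps_of_poly_pCons fls_plus_const fls_times_fps_to_fls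
        fps_to_fls_plus mult.commute)
qed (simp add: fls_eval_def)

lemma M_mat_entry:
  fixes f :: "'a::field poly"
  assumes "i < n" "j < degree f + n"
  shows "M_mat n f $$ (i, j) = coeff (f * [:1, 1:] ^ i) j"
proof -
  have "(1 + fls_X :: 'a fls) = fps_to_fls (fps_of_poly [:1, 1:])"
    by (simp add: fps_of_poly_pCons)
  then have "fls_eval f fls_X * (1 + fls_X) ^ i = fps_to_fls (fps_of_poly (f * [:1, 1:] ^ i))"
    by (simp only: fls_eval_X fps_of_poly_mult fps_of_poly_power fls_times_fps_to_fls
        fps_to_fls_power)
  moreover have "CT (g / fls_X ^ j) = fls_nth g (int j)" for g :: "'a fls"
    by (simp add: CT_def fls_divide_X_power)
  ultimately show ?thesis
    using assms by (simp add: M_mat_def mat1_def)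
qed

end

theory Submission
  imports Defs
begin

text \<open>Let \<open>S(R)\<close> be the sum of the maximal minors of a \<open>2k \<times> N\<close> matrix \<open>R\<close> and let \<open>A\<close> be the
  matrix of signs of \<open>j - i\<close>. The sum \<open>P(Q)\<close> over all permutations of \<open>2k\<close> points that underlies the
  Pfaffian satisfies \<open>P(R A R\<^sup>T) = c * S(R)\<close> and \<open>P(g Q g\<^sup>T) = det g * P(Q)\<close>. The rows of \<open>M\<close> are the
  coefficients of \<open>f * (1 + x) ^ i\<close>, and on multiples \<open>f * p\<close> the form \<open>A\<close> is shift invariant; hence
  the multiples \<open>f * s\<close> by (anti)palindromic \<open>s\<close> are mutually orthogonal. Pairing \<open>f * s\<close> with
  \<open>f * s' * (1 - x) / (1 + x)\<close> yields the constant term of \<open>-s(x) s'(1/x) f(x) f(1/x)\<close> by summation by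
  parts. In this basis the form has a zero block, so \<open>P\<close> reduces to a determinant of half the size.
  All constants that occur are independent of \<open>f\<close>, so the case \<open>f = 1\<close> eliminates them; the only
  thing to check is that they do not vanish. For odd \<open>n\<close> the matrix is first bordered.\<close>

subsection \<open>Pfaffian-type sums\<close>

text \<open>For skew-symmetric \<open>Q\<close> this is \<open>2 ^ k * fact k\<close> times the Pfaffian, up to the sign coming from
  the choice of the reference pairing of \<open>m\<close> with \<open>k + m\<close>.\<close>

definition pairing_sum :: "nat \<Rightarrow> (nat \<Rightarrow> nat \<Rightarrow> 'a::comm_ring_1) \<Rightarrow> 'a" where
  "pairing_sum k Q = (\<Sum>p | p permutes {0..<2*k}. signof p * (\<Prod>m<k. Q (p m) (p (k + m))))"

lemma pairing_sum_cong:
  assumes "\<And>a b. a < 2 * k \<Longrightarrow> b < 2 * k \<Longrightarrow> Q a b = Q' a b"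
  shows "pairing_sum k Q = pairing_sum k Q'"
proof -
  have "p a < 2 * k" if "p permutes {0..<2*k}" "a < 2 * k" for p a
    using permutes_in_image[OF that(1), of a] that(2) by simp
  then show ?thesis
    unfolding pairing_sum_def by (intro sum.cong prod.cong arg_cong2[of _ _ _ _ "(*)"]) (auto intro!: assms)
qed

section \<open>Multilinear expansion and a Cauchy-Binet formula\<close>

lemma prod_lessThan_add:
  fixes g :: "nat \<Rightarrow> 'a::comm_monoid_mult"
  shows "(\<Prod>m<k+l. g m) = (\<Prod>m<k. g m) * (\<Prod>m<l. g (k + m))"
  by (induction l) (simp_all add: mult.assoc)

text \<open>Choosing k pairs amounts to choosing 2k points, the second components being stored at
  positions k + m. The hypothesis on \<open>G\<close> absorbs the differing default values of the
  restricted functions outside their index ranges.\<close>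

lemma sum_PiE_pairs:
  fixes G :: "(nat \<Rightarrow> 'b) \<Rightarrow> (nat \<Rightarrow> 'b) \<Rightarrow> 'a::comm_monoid_add"
  assumes cong: "\<And>a a' b b'. (\<And>m. m < k \<Longrightarrow> a m = a' m \<and> b m = b' m) \<Longrightarrow> G a b = G a' b'"
  shows "(\<Sum>H\<in>{..<k} \<rightarrow>\<^sub>E X \<times> X. G (\<lambda>m. fst (H m)) (\<lambda>m. snd (H m))) =
    (\<Sum>J\<in>{0..<2*k} \<rightarrow>\<^sub>E X. G J (\<lambda>m. J (k + m)))"
proof (rule sum.reindex_bij_witness)
  let ?i = "\<lambda>J. (\<lambda>m::nat\<in>{..<k}. (J m, J (k + m)))"
  let ?j = "\<lambda>H. (\<lambda>m::nat\<in>{0..<2*k}. if m < k then fst (H m) else snd (H (m - k)))"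
  fix H assume H: "H \<in> {..<k} \<rightarrow>\<^sub>E X \<times> X"
  show "?i (?j H) = H"
  proof
    show "?i (?j H) m = H m" for m
      using H by (cases "m < k") (auto simp: PiE_def extensional_def)
  qed
  have *: "fst (H m) \<in> X" "snd (H m) \<in> X" if "m < k" for m
    using that PiE_mem[OF H, of m] by auto
  show "?j H \<in> {0..<2*k} \<rightarrow>\<^sub>E X"
    by (intro restrict_PiE_iff[THEN iffD2]) (auto intro!: *)
  show "G (?j H) (\<lambda>m. ?j H (k + m)) = G (\<lambda>m. fst (H m)) (\<lambda>m. snd (H m))"
    by (rule cong) auto
next
  let ?i = "\<lambda>J. (\<lambda>m::nat\<in>{..<k}. (J m, J (k + m)))"
  let ?j = "\<lambda>H. (\<lambda>m::nat\<in>{0..<2*k}. if m < k then fst (H m) else snd (H (m - k)))"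
  fix J assume J: "J \<in> {0..<2*k} \<rightarrow>\<^sub>E X"
  show "?j (?i J) = J"
  proof
    show "?j (?i J) m = J m" for m
      using J by (cases "m < 2 * k") (auto simp: PiE_def extensional_def)
  qed
  show "?i J \<in> {..<k} \<rightarrow>\<^sub>E X \<times> X"
    using J by (auto intro!: PiE_mem[OF J])
qed

text \<open>Each factor of the product contributes an independent choice of column indices,
  collected in \<open>J\<close>. After exchanging the two sums, the sum over permutations is the
  column expansion of a determinant.\<close>

lemma pairing_sum_expand:
  assumes "finite X"
  shows "pairing_sum k (\<lambda>a b. \<Sum>i\<in>X. \<Sum>j\<in>X. R a i * A i j * R b j) =
    (\<Sum>J\<in>{0..<2*k} \<rightarrow>\<^sub>E X. det (mat (2*k) (2*k) (\<lambda>(a, m). R a (J m))) * (\<Prod>m<k. A (J m) (J (k + m))))"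
proof -
  have expand: "(\<Prod>m<k. \<Sum>i\<in>X. \<Sum>j\<in>X. R (p m) i * A i j * R (p (k + m)) j) =
      (\<Sum>J\<in>{0..<2*k} \<rightarrow>\<^sub>E X. (\<Prod>m<2*k. R (p m) (J m)) * (\<Prod>m<k. A (J m) (J (k + m))))" for p
  proof -
    have "(\<Prod>m<k. \<Sum>i\<in>X. \<Sum>j\<in>X. R (p m) i * A i j * R (p (k + m)) j) =
        (\<Prod>m<k. \<Sum>z\<in>X \<times> X. R (p m) (fst z) * A (fst z) (snd z) * R (p (k + m)) (snd z))"
      by (simp add: sum.cartesian_product split_def)
    also have "\<dots> = (\<Sum>H\<in>{..<k} \<rightarrow>\<^sub>E X \<times> X.
        \<Prod>m<k. R (p m) (fst (H m)) * A (fst (H m)) (snd (H m)) * R (p (k + m)) (snd (H m)))"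
      using assms by (intro prod_sum_PiE) auto
    also have "\<dots> = (\<Sum>J\<in>{0..<2*k} \<rightarrow>\<^sub>E X.
        \<Prod>m<k. R (p m) (J m) * A (J m) (J (k + m)) * R (p (k + m)) (J (k + m)))"
      by (rule sum_PiE_pairs[where G = "\<lambda>a b. \<Prod>m<k. R (p m) (a m) * A (a m) (b m) * R (p (k + m)) (b m)"])
        auto
    finally show ?thesis
      by (simp add: prod.distrib mult_2 prod_lessThan_add mult.assoc) (simp only: ac_simps)
  qed
  have "pairing_sum k (\<lambda>a b. \<Sum>i\<in>X. \<Sum>j\<in>X. R a i * A i j * R b j) =
      (\<Sum>J\<in>{0..<2*k} \<rightarrow>\<^sub>E X. \<Sum>p | p permutes {0..<2*k}.
        signof p * ((\<Prod>m<2*k. R (p m) (J m)) * (\<Prod>m<k. A (J m) (J (k + m)))))"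
    unfolding pairing_sum_def expand sum_distrib_left by (rule sum.swap)
  also have "\<dots> = (\<Sum>J\<in>{0..<2*k} \<rightarrow>\<^sub>E X.
      det (mat (2*k) (2*k) (\<lambda>(a, m). R a (J m))) * (\<Prod>m<k. A (J m) (J (k + m))))"
  proof (rule sum.cong[OF refl])
    fix J
    have "det (mat (2*k) (2*k) (\<lambda>(a, m). R a (J m))) =
        (\<Sum>p | p permutes {0..<2*k}. signof p * (\<Prod>m<2*k. R (p m) (J m)))"
    proof (subst det_col[of _ "2*k"], simp, intro sum.cong arg_cong2[of _ _ _ _ "(*)"] prod.cong refl)
      fix p m assume "p \<in> {p. p permutes {0..<2*k}}" "m \<in> {..<2*k}"
      then have "p m < 2 * k"
        using permutes_in_image[of p "{0..<2*k}" m] by simp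
      then show "mat (2*k) (2*k) (\<lambda>(a, m). R a (J m)) $$ (p m, m) = R (p m) (J m)"
        using \<open>m \<in> {..<2*k}\<close> by simp
    qed
    then show "(\<Sum>p | p permutes {0..<2*k}.
        signof p * ((\<Prod>m<2*k. R (p m) (J m)) * (\<Prod>m<k. A (J m) (J (k + m))))) =
        det (mat (2*k) (2*k) (\<lambda>(a, m). R a (J m))) * (\<Prod>m<k. A (J m) (J (k + m)))"
      by (simp add: sum_distrib_right mult.assoc)
  qed
  finally show ?thesis .
qed

lemma pick_inj_on: "inj_on (pick I) {0..<card I}"
  by (rule linorder_inj_onI) (use pick_mono_le in \<open>fastforce+\<close>)

lemma pick_image: "finite I \<Longrightarrow> pick I ` {0..<card I} = I"
  by (intro card_subset_eq) (auto simp: pick_in_set_le card_image[OF pick_inj_on])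

text \<open>An injective \<open>J\<close> factors uniquely through its image I: a permutation
  followed by the increasing enumeration of I.\<close>

lemma sum_PiE_inj:
  fixes F :: "(nat \<Rightarrow> nat) \<Rightarrow> 'a::comm_monoid_add"
  assumes "\<And>J. J \<in> {0..<n} \<rightarrow>\<^sub>E {..<N} \<Longrightarrow> \<not> inj_on J {0..<n} \<Longrightarrow> F J = 0"
  shows "(\<Sum>J\<in>{0..<n} \<rightarrow>\<^sub>E {..<N}. F J) =
    (\<Sum>I | I \<subseteq> {..<N} \<and> card I = n. \<Sum>p | p permutes {0..<n}. F (\<lambda>m\<in>{0..<n}. pick I (p m)))"
proof -
  let ?S = "{J \<in> {0..<n} \<rightarrow>\<^sub>E {..<N}. inj_on J {0..<n}}"
  let ?T = "{I. I \<subseteq> {..<N} \<and> card I = n} \<times> {p. p permutes {0..<n}}"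
  let ?j = "\<lambda>z. (\<lambda>m\<in>{0..<n}. pick (fst z) (snd z m))"
  have "(\<Sum>J\<in>{0..<n} \<rightarrow>\<^sub>E {..<N}. F J) = (\<Sum>J\<in>?S. F J)"
    using assms by (intro sum.mono_neutral_right finite_PiE) auto
  also have "\<dots> = (\<Sum>z\<in>?T. F (?j z))"
  proof (rule sum.reindex_bij_betw[symmetric], rule bij_betw_imageI)
    have fin: "finite I" if "I \<subseteq> {..<N}" for I :: "nat set"
      using that finite_subset by blast
    have img: "?j (I, p) ` {0..<n} = I" if "I \<subseteq> {..<N}" "card I = n" "p permutes {0..<n}" for I p
    proof -
      have "?j (I, p) ` {0..<n} = pick I ` (p ` {0..<n})"
        by (auto simp: image_image)
      also have "\<dots> = I"
        using that pick_image[OF fin[of I]] by (simp add: permutes_image)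
      finally show ?thesis .
    qed
    show "inj_on ?j ?T"
    proof (rule inj_onI)
      fix z z' assume "z \<in> ?T" "z' \<in> ?T" and eq': "?j z = ?j z'"
      then obtain I p I' p' where z: "z = (I, p)" "z' = (I', p')"
        and I: "I \<subseteq> {..<N}" and I': "I' \<subseteq> {..<N}" "card I' = card I" and n: "n = card I"
        and p: "p permutes {0..<card I}" and p': "p' permutes {0..<card I}"
        by auto
      note eq = eq'[unfolded z]
      have II: "I = I'"
        using img[of I p] img[of I' p'] eq I I' p p' n by metis
      have "p m = p' m" for m
      proof (cases "m < card I")
        case True
        then have "pick I (p m) = pick I (p' m)"
          using fun_cong[OF eq, of m] II n by simp
        moreover have "p m < card I" "p' m < card I"
          using True permutes_in_image[OF p, of m] permutes_in_image[OF p', of m] by auto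
        ultimately show ?thesis
          using pick_inj_on[of I] by (auto dest: inj_onD)
      qed (use p p' in \<open>simp add: permutes_not_in\<close>)
      then show "z = z'"
        using II z by auto
    qed
    show "?j ` ?T = ?S"
    proof (intro equalityI subsetI)
      fix J assume "J \<in> ?j ` ?T"
      then obtain I p where J: "J = ?j (I, p)" and I: "I \<subseteq> {..<N}" "card I = n" and p: "p permutes {0..<n}"
        by auto
      have "card (J ` {0..<n}) = card {0..<n}"
        using img[OF I p] I(2) J by simp
      then have "inj_on J {0..<n}"
        by (intro eq_card_imp_inj_on) auto
      moreover have "J \<in> {0..<n} \<rightarrow>\<^sub>E {..<N}"
        using img[OF I p] I(1) J by auto
      ultimately show "J \<in> ?S" by simp
    next
      fix J assume J: "J \<in> ?S"
      define I where "I = J ` {0..<n}"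
      \<comment> \<open>The rank of \<open>J m\<close> within the image, which \<open>pick\<close>
        turns back into \<open>J m\<close>.\<close>
      define p where "p = (\<lambda>m. if m < n then card {a\<in>I. a < J m} else m)"
      have I: "I \<subseteq> {..<N}" "card I = n"
        using J unfolding I_def by (auto simp: card_image)
      have pick_p: "pick I (p m) = J m" if "m < n" for m
        using that unfolding p_def by (simp add: pick_card_in_set I_def)
      have p_less: "p m < n" if "m < n" for m
      proof -
        have "{a\<in>I. a < J m} \<subset> I"
          using that unfolding I_def by auto
        then show ?thesis
          using psubset_card_mono[OF fin[OF I(1)]] I(2) that unfolding p_def by simp
      qed
      have "inj_on p {0..<n}"
        using J pick_p by (metis (mono_tags, lifting) atLeastLessThan_iff inj_on_def mem_Collect_eq)
      then have "p permutes {0..<n}"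
        using p_less by (intro bij_imp_permutes bij_betw_imageI endo_inj_surj) (auto simp: p_def)
      moreover have "J = ?j (I, p)"
        using J pick_p by (auto simp: PiE_def extensional_def fun_eq_iff)
      ultimately show "J \<in> ?j ` ?T"
        using I by blast
    qed
  qed
  finally show ?thesis
    by (simp add: sum.cartesian_product split_def)
qed

lemma det_permute_cols:
  fixes B :: "nat \<Rightarrow> nat \<Rightarrow> 'a::comm_ring_1"
  assumes "p permutes {0..<n}"
  shows "det (mat n n (\<lambda>(a, m). B a (p m))) = signof p * det (mat n n (\<lambda>(a, m). B a m))"
proof -
  have p: "p m < n" if "m < n" for m
    using that permutes_in_image[OF assms, of m] by simp
  have "det (mat n n (\<lambda>(a, m). B a (p m))) = det (mat n n (\<lambda>(m, a). B a (p m)))"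
    by (subst det_transpose[of _ n, symmetric]) (auto intro!: arg_cong[of _ _ det] eq_matI)
  also have "mat n n (\<lambda>(m, a). B a (p m)) = mat n n (\<lambda>(i, j). mat n n (\<lambda>(m, a). B a m) $$ (p i, j))"
    using p by (auto intro!: eq_matI)
  also have "det \<dots> = signof p * det (mat n n (\<lambda>(m, a). B a m))"
    using assms by (intro det_permute_rows) auto
  also have "det (mat n n (\<lambda>(m, a). B a m)) = det (mat n n (\<lambda>(a, m). B a m))"
    by (subst det_transpose[of _ n, symmetric]) (auto intro!: arg_cong[of _ _ det] eq_matI)
  finally show ?thesis .
qed

text \<open>Cauchy-Binet for pairing sums. A non-injective \<open>J\<close> gives equal columns and
  drops out. For the others, sorting the columns costs the sign of p, which is exactly the sign
  needed for the pairing sum of the principal submatrix of \<open>A\<close> on I.\<close>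

lemma pairing_sum_congruence:
  "pairing_sum k (\<lambda>a b. \<Sum>i<N. \<Sum>j<N. R a i * A i j * R b j) =
    (\<Sum>I | I \<subseteq> {..<N} \<and> card I = 2 * k.
      det (mat (2*k) (2*k) (\<lambda>(a, m). R a (pick I m))) * pairing_sum k (\<lambda>a b. A (pick I a) (pick I b)))"
proof -
  let ?n = "2 * k"
  let ?F = "\<lambda>J :: nat \<Rightarrow> nat. det (mat ?n ?n (\<lambda>(a, m). R a (J m))) * (\<Prod>m<k. A (J m) (J (k + m)))"
  have "pairing_sum k (\<lambda>a b. \<Sum>i<N. \<Sum>j<N. R a i * A i j * R b j) = (\<Sum>J\<in>{0..<?n} \<rightarrow>\<^sub>E {..<N}. ?F J)"
    by (rule pairing_sum_expand) simp
  also have "\<dots> = (\<Sum>I | I \<subseteq> {..<N} \<and> card I = ?n.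
      \<Sum>p | p permutes {0..<?n}. ?F (\<lambda>m\<in>{0..<?n}. pick I (p m)))"
  proof (rule sum_PiE_inj)
    fix J :: "nat \<Rightarrow> nat" assume "\<not> inj_on J {0..<?n}"
    then obtain a b where "a < ?n" "b < ?n" "a \<noteq> b" "J a = J b"
      by (auto simp: inj_on_def)
    then have "det (mat ?n ?n (\<lambda>(a, m). R a (J m))) = 0"
      by (intro det_identical_columns[of _ ?n a b]) (auto intro!: eq_vecI)
    then show "?F J = 0" by simp
  qed
  also have "\<dots> = (\<Sum>I | I \<subseteq> {..<N} \<and> card I = ?n.
      det (mat ?n ?n (\<lambda>(a, m). R a (pick I m))) * pairing_sum k (\<lambda>a b. A (pick I a) (pick I b)))"
  proof (rule sum.cong[OF refl])
    fix I
    have "?F (\<lambda>m\<in>{0..<?n}. pick I (p m)) = det (mat ?n ?n (\<lambda>(a, m). R a (pick I m))) *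
        (signof p * (\<Prod>m<k. A (pick I (p m)) (pick I (p (k + m)))))" if p: "p permutes {0..<?n}" for p
    proof -
      have "mat ?n ?n (\<lambda>(a, m). R a ((\<lambda>m\<in>{0..<?n}. pick I (p m)) m)) = mat ?n ?n (\<lambda>(a, m). R a (pick I (p m)))"
        by (rule eq_matI) auto
      then show ?thesis
        using det_permute_cols[OF p, of "\<lambda>a m. R a (pick I m)"] by (simp add: ac_simps)
    qed
    then show "(\<Sum>p | p permutes {0..<?n}. ?F (\<lambda>m\<in>{0..<?n}. pick I (p m))) =
        det (mat ?n ?n (\<lambda>(a, m). R a (pick I m))) * pairing_sum k (\<lambda>a b. A (pick I a) (pick I b))"
      by (simp add: pairing_sum_def sum_distrib_left)
  qed
  finally show ?thesis .
qed

lemma pick_lessThan: "a < n \<Longrightarrow> pick {..<n} a = a"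
proof -
  assume a: "a < n"
  then have "{b \<in> {..<n}. b < a} = {..<a}" by auto
  then show ?thesis
    using pick_card_in_set[of a "{..<n}"] a by simp
qed

lemma pairing_sum_transform:
  "pairing_sum k (\<lambda>a b. \<Sum>i<2*k. \<Sum>j<2*k. g a i * Q i j * g b j) =
    det (mat (2*k) (2*k) (\<lambda>(a, i). g a i)) * pairing_sum k Q"
proof -
  have "{I. I \<subseteq> {..<2*k} \<and> card I = 2*k} = {{..<2*k}}"
    using card_subset_eq[of "{..<2*k}"] by auto
  moreover have "mat (2*k) (2*k) (\<lambda>(a, i). g a (pick {..<2*k} i)) = mat (2*k) (2*k) (\<lambda>(a, i). g a i)"
    by (rule eq_matI) (auto simp: pick_lessThan)
  moreover have "pairing_sum k (\<lambda>a b. Q (pick {..<2*k} a) (pick {..<2*k} b)) = pairing_sum k Q"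
    by (rule pairing_sum_cong) (simp add: pick_lessThan)
  ultimately show ?thesis
    by (simp add: pairing_sum_congruence)
qed

subsection \<open>Sums of maximal minors\<close>

definition order_sign :: "nat \<Rightarrow> nat \<Rightarrow> 'a::comm_ring_1" where
  "order_sign i j = (if i < j then 1 else if j < i then - 1 else 0)"

text \<open>Since \<open>pick I\<close> is increasing, every principal submatrix of the sign matrix
  is the sign matrix of its own size. All index sets I thus carry the same pairing sum, and the
  unweighted sum of minors factors out.\<close>

lemma order_sign_pick:
  assumes "a < card I" "b < card I"
  shows "order_sign (pick I a) (pick I b) = order_sign a b"
  using pick_mono_le[of b I a] pick_mono_le[of a I b] assms
  by (cases a b rule: linorder_cases) (auto simp: order_sign_def)

definition minor_sum :: "nat \<Rightarrow> nat \<Rightarrow> (nat \<Rightarrow> nat \<Rightarrow> 'a::comm_ring_1) \<Rightarrow> 'a" where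
  "minor_sum n N R = (\<Sum>I | I \<subseteq> {..<N} \<and> card I = n. det (mat n n (\<lambda>(a, m). R a (pick I m))))"

lemma pairing_sum_order_sign:
  "pairing_sum k (\<lambda>a b. \<Sum>i<N. \<Sum>j<N. R a i * order_sign i j * R b j) =
    minor_sum (2 * k) N R * pairing_sum k order_sign"
proof -
  have "pairing_sum k (\<lambda>a b. order_sign (pick I a) (pick I b)) = (pairing_sum k order_sign :: 'a)"
    if "card I = 2 * k" for I
    by (rule pairing_sum_cong) (use that in \<open>simp add: order_sign_pick\<close>)
  then show ?thesis
    by (simp add: pairing_sum_congruence minor_sum_def sum_distrib_right)
qed

subsection \<open>Forms with an isotropic half\<close>

text \<open>The standard symplectic matrix, adapted to the reference pairing in
  \<open>pairing_sum\<close>.\<close>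

definition symplectic :: "nat \<Rightarrow> nat \<Rightarrow> nat \<Rightarrow> 'a::comm_ring_1" where
  "symplectic k a b = (if a < k \<and> b = k + a then 1 else if b < k \<and> a = k + b then - 1 else 0)"

lemma sum_lessThan_add:
  fixes g :: "nat \<Rightarrow> 'a::comm_monoid_add"
  shows "(\<Sum>m<k+l. g m) = (\<Sum>m<k. g m) + (\<Sum>m<l. g (k + m))"
  by (induction l) (simp_all add: add.assoc)

lemma sum_symplectic:
  "(\<Sum>i<2*k. \<Sum>j<2*k. u i * symplectic k i j * v j) = (\<Sum>m<k. u m * v (k + m) - u (k + m) * v m)"
proof -
  have "(\<Sum>j<2*k. u m * symplectic k m j * v j) = u m * v (k + m)" if "m < k" for m
  proof -
    have "u m * symplectic k m j * v j = (if j = k + m then u m * v (k + m) else 0)" if "j < 2 * k" for j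
      using \<open>m < k\<close> that by (auto simp: symplectic_def)
    then show ?thesis
      using that by (simp add: sum.delta)
  qed
  moreover have "(\<Sum>j<2*k. u (k + m) * symplectic k (k + m) j * v j) = - (u (k + m) * v m)" if "m < k" for m
  proof -
    have "u (k + m) * symplectic k (k + m) j * v j = (if j = m then - (u (k + m) * v m) else 0)"
      if "j < 2 * k" for j
      using \<open>m < k\<close> that by (auto simp: symplectic_def)
    then show ?thesis
      using that by (simp add: sum.delta)
  qed
  ultimately show ?thesis
    by (simp only: mult_2 sum_lessThan_add[of _ k k]) (simp add: sum_subtractf sum_negf flip: mult_2)
qed

text \<open>Such a \<open>Q\<close> is \<open>g * symplectic * g\<^sup>T\<close> for a block lower triangular \<open>g\<close>: with \<open>B\<close> and \<open>E\<close> the upper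
  right and lower right blocks of \<open>Q\<close>, and \<open>X\<close> the strict upper triangle of \<open>E\<close>, take
  \<open>g = [[B, 0], [X, 1]]\<close>, using \<open>X - X\<^sup>T = E\<close>.\<close>

lemma pairing_sum_isotropic:
  fixes Q :: "nat \<Rightarrow> nat \<Rightarrow> 'a::idom"
  assumes zero: "\<And>a b. a < k \<Longrightarrow> b < k \<Longrightarrow> Q a b = 0"
    and skew: "\<And>a b. Q b a = - Q a b" and diag: "\<And>a. Q a a = 0"
  shows "pairing_sum k Q = det (mat k k (\<lambda>(a, b). Q a (k + b))) * pairing_sum k (symplectic k)"
proof -
  define X where "X a b = (if a < b then Q (k + a) (k + b) else 0)" for a b
  define g where "g a i =
    (if a < k then if i < k then Q a (k + i) else 0
     else if i < k then X (a - k) i else if i = a then 1 else 0)" for a i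
  have g: "g a i = Q a (k + i)" "g a (k + i) = 0" "g (k + a) i = X a i"
    "g (k + a) (k + i) = (if i = a then 1 else 0)" if "a < k" "i < k" for a i
    using that by (auto simp: g_def)
  have "Q a b = (\<Sum>m<k. g a m * g b (k + m) - g a (k + m) * g b m)" if a: "a < 2 * k" and b: "b < 2 * k" for a b
  proof (cases "a < k"; cases "b < k")
    assume "a < k" "b < k"
    then show ?thesis by (simp add: g zero)
  next
    assume "a < k" "\<not> b < k"
    moreover then obtain b' where "b = k + b'" "b' < k"
      using b by (metis add_less_cancel_left le_Suc_ex linorder_not_less mult_2)
    ultimately show ?thesis
      by (simp add: g if_distrib[of "\<lambda>x. _ * x"] sum.delta cong: if_cong)
  next
    assume "\<not> a < k" "b < k"
    moreover then obtain a' where "a = k + a'" "a' < k"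
      using a by (metis add_less_cancel_left le_Suc_ex linorder_not_less mult_2)
    ultimately show ?thesis
      by (simp add: g if_distrib[of "\<lambda>x. x * _"] sum.delta sum_negf skew[of "k + a'" b] cong: if_cong)
  next
    assume "\<not> a < k" "\<not> b < k"
    moreover then obtain a' b' where ab: "a = k + a'" "a' < k" "b = k + b'" "b' < k"
      using a b by (metis add_less_cancel_left le_Suc_ex linorder_not_less mult_2)
    have "X a' b' - X b' a' = Q a b"
      using skew[of a b] diag ab by (auto simp: X_def)
    with ab show ?thesis
      by (simp add: g if_distrib[of "\<lambda>x. _ * x"] if_distrib[of "\<lambda>x. x * _"] sum_subtractf sum.delta cong: if_cong)
  qed
  then have "pairing_sum k Q = pairing_sum k (\<lambda>a b. \<Sum>i<2*k. \<Sum>j<2*k. g a i * symplectic k i j * g b j)"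
    by (intro pairing_sum_cong) (simp add: sum_symplectic)
  also have "\<dots> = det (mat (2*k) (2*k) (\<lambda>(a, i). g a i)) * pairing_sum k (symplectic k)"
    by (rule pairing_sum_transform)
  also have "mat (2*k) (2*k) (\<lambda>(a, i). g a i) =
      four_block_mat (mat k k (\<lambda>(a, b). Q a (k + b))) (0\<^sub>m k k) (mat k k (\<lambda>(a, i). X a i)) (1\<^sub>m k)"
    by (rule eq_matI) (auto simp: g_def)
  also have "det \<dots> = det (mat k k (\<lambda>(a, b). Q a (k + b))) * det (1\<^sub>m k)"
    by (rule det_four_block_mat_upper_right_zero) auto
  finally show ?thesis by simp
qed

section \<open>Signs of permutations that respect the pairing\<close>

definition double_perm :: "nat \<Rightarrow> (nat \<Rightarrow> nat) \<Rightarrow> nat \<Rightarrow> nat" where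
  "double_perm k p i = (if i < k then p i else if i < 2 * k then k + p (i - k) else i)"

definition flip_pairs :: "nat \<Rightarrow> nat set \<Rightarrow> nat \<Rightarrow> nat" where
  "flip_pairs k F i = (if i \<in> F then k + i else if k \<le> i \<and> i - k \<in> F then i - k else i)"

text \<open>A transposition of two pairs is a product of two transpositions of points, so each
  induction step preserves the sign.\<close>

lemma sign_double_perm:
  assumes "p permutes {..<k}"
  shows "permutation (double_perm k p) \<and> sign (double_perm k p) = 1"
  using assms finite_lessThan
proof (induction rule: permutes_induct)
  case id
  have "double_perm k id = id"
    by (auto simp: double_perm_def)
  then show ?case
    by (simp only: sign_id permutation_id simp_thms)
next
  case (swap a b p)
  let ?t = "transpose a b \<circ> transpose (k + a) (k + b)"
  have lt: "p i < k" if "i < k" for i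
    using permutes_in_image[OF swap(4), of i] that by simp
  have eq: "double_perm k (transpose a b \<circ> p) = ?t \<circ> double_perm k p"
  proof
    fix i
    show "double_perm k (transpose a b \<circ> p) i = (?t \<circ> double_perm k p) i"
      using lt[of i] lt[of "i - k"] swap(1,2) by (auto simp: double_perm_def transpose_def)
  qed
  have "permutation ?t" "sign ?t = 1"
    using swap(3) by (simp_all add: permutation_compose permutation_swap_id sign_compose sign_swap_id)
  then show ?case
    using swap(5) unfolding eq by (simp add: permutation_compose sign_compose del: o_apply)
qed

lemma sign_flip_pairs:
  assumes "finite F" "F \<subseteq> {..<k}"
  shows "permutation (flip_pairs k F) \<and> sign (flip_pairs k F) = (-1) ^ card F"
  using assms
proof (induction F)
  case empty
  have "flip_pairs k {} = id"
    by (auto simp: flip_pairs_def)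
  then show ?case by simp
next
  case (insert m F)
  have eq: "flip_pairs k (insert m F) = transpose m (k + m) \<circ> flip_pairs k F"
  proof
    fix i
    show "flip_pairs k (insert m F) i = (transpose m (k + m) \<circ> flip_pairs k F) i"
      using insert(2,4) by (auto simp: flip_pairs_def transpose_def)
  qed
  show ?case
    using insert unfolding eq
    by (auto simp add: permutation_compose permutation_swap_id sign_compose sign_swap_id simp del: o_apply)
qed

text \<open>A permutation respecting the pairing is a pair of copies of one permutation of the pairs (even),
  composed with swaps inside pairs, each of which is compensated by a sign of \<^const>\<open>symplectic\<close>.\<close>

lemma pairing_sum_symplectic_term:
  assumes p: "p permutes {0..<2*k}"
    and nz: "\<And>m. m < k \<Longrightarrow> symplectic k (p m) (p (k + m)) \<noteq> (0::'a::comm_ring_1)"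
  shows "signof p * (\<Prod>m<k. symplectic k (p m) (p (k + m))) = (1::'a)"
proof -
  have pair: "p (k + m) = k + p m \<and> p m < k \<or> p m = k + p (k + m) \<and> p (k + m) < k" if "m < k" for m
    using nz[OF that] by (auto simp: symplectic_def split: if_splits)
  \<comment> \<open>The pairs whose image is reversed. Undoing these reversals first leaves a map
    that carries each half as \<open>q\<close> prescribes.\<close>
  define F where "F = {m. m < k \<and> p (k + m) < k}"
  define q where "q m = (if m < k then if m \<in> F then p (k + m) else p m else m)" for m
  have F: "finite F" "F \<subseteq> {..<k}" by (auto simp: F_def)
  have eq: "p \<circ> flip_pairs k F = double_perm k q"
  proof
    fix i
    consider "i < k" | m where "i = k + m" "m < k" | "2 * k \<le> i"
      by (metis add_less_cancel_left le_Suc_ex linorder_not_less mult_2)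
    then show "(p \<circ> flip_pairs k F) i = double_perm k q i"
    proof cases
      case 1
      then show ?thesis
        by (auto simp: flip_pairs_def double_perm_def q_def)
    next
      case 2
      then show ?thesis
        using pair[of m] by (auto simp: flip_pairs_def double_perm_def q_def F_def)
    next
      case 3
      then show ?thesis
        using permutes_not_in[OF p, of i] by (auto simp: flip_pairs_def double_perm_def F_def)
    qed
  qed
  have "permutation p"
    using p by (auto simp: permutation_permutes)
  note fl = sign_flip_pairs[OF F]
  have "inj (double_perm k q)"
    using fl permutation_bijective[of p] permutation_bijective[of "flip_pairs k F"] \<open>permutation p\<close>
    by (simp add: bij_is_inj inj_compose flip: eq)
  moreover have "q m < k" if "m < k" for m
    using pair[OF that] that by (auto simp: q_def F_def)
  moreover have "double_perm k q m = q m" if "m < k" for m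
    using that by (simp add: double_perm_def)
  ultimately have "inj_on q {..<k}" "q ` {..<k} \<subseteq> {..<k}"
    unfolding inj_on_def by (metis UNIV_I lessThan_iff, blast)
  then have "q permutes {..<k}"
    by (intro bij_imp_permutes bij_betw_imageI endo_inj_surj) (auto simp: q_def)
  then have "sign p * sign (flip_pairs k F) = 1"
    using sign_double_perm[of q k] fl \<open>permutation p\<close> by (metis eq sign_compose)
  moreover have "sign p = sign p * sign (flip_pairs k F) * sign (flip_pairs k F)"
    by (simp only: mult.assoc sign_idempotent mult_1_right)
  ultimately have "sign p = (-1) ^ card F"
    using fl by simp
  moreover have "(\<Prod>m<k. symplectic k (p m) (p (k + m))) = (\<Prod>m<k. if m \<in> F then - 1 else (1::'a))"
  proof (rule prod.cong[OF refl])
    fix m assume "m \<in> {..<k}"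
    then show "symplectic k (p m) (p (k + m)) = (if m \<in> F then - 1 else (1::'a))"
      using pair[of m] by (auto simp: symplectic_def F_def)
  qed
  moreover have "\<dots> = (-1) ^ card F"
    using F by (simp add: prod.If_cases Int_absorb1)
  ultimately show ?thesis
    by (simp flip: power_mult_distrib)
qed

text \<open>All nonzero terms equal 1, so the sum counts them. The identity is one of them, and
  characteristic 0 keeps the count nonzero.\<close>

lemma pairing_sum_symplectic_nonzero:
  "pairing_sum k (symplectic k) \<noteq> (0 :: 'a::{comm_ring_1,ring_char_0})"
proof -
  let ?t = "\<lambda>p. signof p * (\<Prod>m<k. symplectic k (p m) (p (k + m))) :: 'a"
  let ?S = "{p. p permutes {0..<2*k}}" and ?H = "{p. p permutes {0..<2*k} \<and> ?t p \<noteq> 0}"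
  have fin: "finite ?S"
    by (rule finite_permutations) simp
  have one: "?t p = 1" if "p \<in> ?H" for p
  proof (rule pairing_sum_symplectic_term)
    fix m assume m: "m < k"
    show "symplectic k (p m) (p (k + m)) \<noteq> (0::'a)"
    proof
      assume "symplectic k (p m) (p (k + m)) = (0::'a)"
      then have "(\<Prod>m<k. symplectic k (p m) (p (k + m))) = (0::'a)"
        using m by (intro prod_zero) auto
      then show False
        using that by simp
    qed
  qed (use that in simp)
  have "pairing_sum k (symplectic k) = (\<Sum>p\<in>?H. ?t p)"
    unfolding pairing_sum_def using fin by (intro sum.mono_neutral_right) auto
  also have "\<dots> = (\<Sum>p\<in>?H. 1)"
    by (rule sum.cong[OF refl one])
  finally have "pairing_sum k (symplectic k) = (of_nat (card ?H) :: 'a)"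
    by simp
  moreover have "id \<in> ?H"
    by (simp add: permutes_id symplectic_def)
  then have "?H \<noteq> {}" by blast
  with fin have "card ?H \<noteq> 0"
    by (simp only: card_eq_0_iff) (simp add: finite_subset)
  ultimately show ?thesis by simp
qed

subsection \<open>Bordering\<close>

text \<open>Expansion along the added unit row kills every minor that avoids the last column and
  strips that column from the others. This makes an odd number of rows even.\<close>

lemma minor_sum_border:
  assumes row: "\<And>j. j \<le> N \<Longrightarrow> R n j = (if j = N then 1 else 0)"
  shows "minor_sum (Suc n) (Suc N) R = minor_sum n N R"
proof -
  let ?D = "\<lambda>I. det (mat (Suc n) (Suc n) (\<lambda>(a, m). R a (pick I m)))"
  have laplace: "?D I = (\<Sum>m<Suc n. (if pick I m = N then 1 else 0) *
      cofactor (mat (Suc n) (Suc n) (\<lambda>(a, m). R a (pick I m))) n m)"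
    if "I \<subseteq> {..<Suc N}" "card I = Suc n" for I
  proof (subst laplace_expansion_row[of _ "Suc n" n], simp, simp, rule sum.cong[OF refl])
    fix m assume "m \<in> {..<Suc n}"
    then show "mat (Suc n) (Suc n) (\<lambda>(a, m). R a (pick I m)) $$ (n, m) *
        cofactor (mat (Suc n) (Suc n) (\<lambda>(a, m). R a (pick I m))) n m =
      (if pick I m = N then 1 else 0) * cofactor (mat (Suc n) (Suc n) (\<lambda>(a, m). R a (pick I m))) n m"
      using pick_in_set_le[of m I] that row[of "pick I m"] by auto
  qed
  have "minor_sum (Suc n) (Suc N) R = (\<Sum>I | I \<subseteq> {..<Suc N} \<and> card I = Suc n \<and> N \<in> I. ?D I)"
    unfolding minor_sum_def
  proof (rule sum.mono_neutral_right)
    show "\<forall>I\<in>{I. I \<subseteq> {..<Suc N} \<and> card I = Suc n} - {I. I \<subseteq> {..<Suc N} \<and> card I = Suc n \<and> N \<in> I}. ?D I = 0"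
    proof
      fix I assume I: "I \<in> {I. I \<subseteq> {..<Suc N} \<and> card I = Suc n} - {I. I \<subseteq> {..<Suc N} \<and> card I = Suc n \<and> N \<in> I}"
      then have "pick I m \<noteq> N" if "m < Suc n" for m
        using pick_in_set_le[of m I] that by auto
      then show "?D I = 0"
        using I by (subst laplace) (auto intro!: sum.neutral)
    qed
  qed (auto intro: finite_subset[of _ "Pow {..<Suc N}"])
  also have "\<dots> = (\<Sum>I | I \<subseteq> {..<N} \<and> card I = n. ?D (insert N I))"
  proof (rule sum.reindex_bij_witness[of _ "insert N" "\<lambda>I. I - {N}"])
    fix I assume "I \<in> {I. I \<subseteq> {..<N} \<and> card I = n}"
    then have "finite I" "N \<notin> I" "I \<subseteq> {..<N}" "card I = n"
      using finite_subset by auto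
    then show "insert N I - {N} = I" "insert N I \<in> {I. I \<subseteq> {..<Suc N} \<and> card I = Suc n \<and> N \<in> I}"
      by auto
  next
    fix I assume I: "I \<in> {I. I \<subseteq> {..<Suc N} \<and> card I = Suc n \<and> N \<in> I}"
    then have "finite I"
      using finite_subset by auto
    then show "I - {N} \<in> {I. I \<subseteq> {..<N} \<and> card I = n}"
      using I by (auto simp: less_Suc_eq)
  qed (auto simp: insert_absorb)
  also have "\<dots> = minor_sum n N R"
    unfolding minor_sum_def
  proof (rule sum.cong[OF refl])
    fix I assume I: "I \<in> {I. I \<subseteq> {..<N} \<and> card I = n}"
    then have fin: "finite I" and N: "N \<notin> I"
      using finite_subset by auto
    have card: "card (insert N I) = Suc n"
      using I fin N by simp
    have pick: "pick (insert N I) m = pick I m" "pick I m < N" if "m < n" for m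
    proof -
      have m: "pick I m \<in> I" "card {a\<in>I. a < pick I m} = m"
        using pick_in_set_le[of m I] card_pick_le[of m I] I that by auto
      then show lt: "pick I m < N" using I by auto
      then have "{a\<in>insert N I. a < pick I m} = {a\<in>I. a < pick I m}" by auto
      then show "pick (insert N I) m = pick I m"
        using pick_card_in_set[of "pick I m" "insert N I"] m by simp
    qed
    have "{a\<in>insert N I. a < N} = I"
      using I by auto
    then have last: "pick (insert N I) n = N"
      using pick_card_in_set[of N "insert N I"] I by simp
    \<comment> \<open>N exceeds all of I, so it is picked last; the surviving cofactor sits on the
      diagonal and has sign +1.\<close>
    have "?D (insert N I) = cofactor (mat (Suc n) (Suc n) (\<lambda>(a, m). R a (pick (insert N I) m))) n n"
    proof (subst laplace)
      have "(\<Sum>m<n. (if pick (insert N I) m = N then 1 else 0) *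
          cofactor (mat (Suc n) (Suc n) (\<lambda>(a, m). R a (pick (insert N I) m))) n m) = 0"
        using pick by (intro sum.neutral) auto
      then show "(\<Sum>m<Suc n. (if pick (insert N I) m = N then 1 else 0) *
          cofactor (mat (Suc n) (Suc n) (\<lambda>(a, m). R a (pick (insert N I) m))) n m) =
        cofactor (mat (Suc n) (Suc n) (\<lambda>(a, m). R a (pick (insert N I) m))) n n"
        by (simp add: last)
    qed (use I card in auto)
    also have "\<dots> = det (mat n n (\<lambda>(a, m). R a (pick I m)))"
      by (auto simp: cofactor_def mat_delete_def pick intro!: arg_cong[of _ _ det] eq_matI)
    finally show "?D (insert N I) = det (mat n n (\<lambda>(a, m). R a (pick I m)))" .
  qed
  finally show ?thesis .
qed

subsection \<open>The order form on polynomials\<close>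

text \<open>The Gram matrix of this form on the rows of R is the matrix
  \<open>R A R\<^sup>T\<close>.\<close>

definition order_form :: "nat \<Rightarrow> 'a::comm_ring_1 poly \<Rightarrow> 'a poly \<Rightarrow> 'a" where
  "order_form N p q = (\<Sum>i<N. \<Sum>j<N. coeff p i * order_sign i j * coeff q j)"

lemma order_form_skew: "order_form N q p = - order_form N p q"
proof -
  have "order_form N q p = (\<Sum>j<N. \<Sum>i<N. coeff q i * order_sign i j * coeff p j)"
    unfolding order_form_def by (rule sum.swap)
  also have "\<dots> = (\<Sum>j<N. \<Sum>i<N. - (coeff p j * order_sign j i * coeff q i))"
    by (intro sum.cong refl) (auto simp: order_sign_def)
  finally show ?thesis
    by (simp add: order_form_def sum_negf)
qed

lemma order_form_self: "order_form N p p = (0 :: 'a::{idom,ring_char_0})"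
  using order_form_skew[of N p p] by (simp add: eq_neg_iff_add_eq_0 flip: mult_2)

lemma order_form_add:
  "order_form N (p + p') q = order_form N p q + order_form N p' q"
  "order_form N p (q + q') = order_form N p q + order_form N p q'"
  by (simp_all add: order_form_def algebra_simps sum.distrib)

lemma order_form_smult:
  "order_form N (Polynomial.smult c p) q = c * order_form N p q"
  "order_form N p (Polynomial.smult c q) = c * order_form N p q"
  by (simp_all add: order_form_def sum_distrib_left ac_simps)

lemma order_form_sum:
  "order_form N (\<Sum>i\<in>S. f i) q = (\<Sum>i\<in>S. order_form N (f i) q)"
  "order_form N p (\<Sum>i\<in>S. f i) = (\<Sum>i\<in>S. order_form N p (f i))"
proof -
  have 0: "order_form N 0 q = 0" "order_form N p 0 = 0"
    by (simp_all add: order_form_def)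
  show "order_form N (\<Sum>i\<in>S. f i) q = (\<Sum>i\<in>S. order_form N (f i) q)"
    by (induction S rule: infinite_finite_induct) (simp_all add: 0 order_form_add)
  show "order_form N p (\<Sum>i\<in>S. f i) = (\<Sum>i\<in>S. order_form N p (f i))"
    by (induction S rule: infinite_finite_induct) (simp_all add: 0 order_form_add)
qed

lemma order_form_Suc:
  assumes "coeff p N = 0" "coeff q N = 0"
  shows "order_form (Suc N) p q = order_form N p q"
  using assms by (simp add: order_form_def)

text \<open>\<open>order_sign\<close> depends only on the difference of the indices, and the
  vanishing top coefficients ensure that nothing is shifted out of range.\<close>

lemma order_form_pCons:
  assumes "coeff p (N - 1) = 0" "coeff q (N - 1) = 0"
  shows "order_form N (pCons 0 p) (pCons 0 q) = order_form N p q"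
proof (cases N)
  case (Suc N')
  have "order_sign (Suc i) (Suc j) = (order_sign i j :: 'a)" for i j
    by (simp add: order_sign_def)
  then have "order_form (Suc N') (pCons 0 p) (pCons 0 q) = order_form N' p q"
    by (simp add: order_form_def sum.lessThan_Suc_shift del: sum.lessThan_Suc)
  then show ?thesis
    using assms Suc by (simp add: order_form_Suc)
qed (simp add: order_form_def)

lemma degree_mult_monom_le:
  fixes f :: "'a::comm_semiring_1 poly"
  shows "degree (f * monom 1 a) \<le> degree f + a"
  using degree_mult_le[of f "monom 1 a"] degree_monom_le[of "1::'a" a]
  by (metis (no_types) add_le_cancel_left order_trans)

lemma order_form_shift:
  assumes "degree f + a + m < N" "degree f + b + m < N"
  shows "order_form N (f * monom 1 (a + m)) (f * monom 1 (b + m)) = order_form N (f * monom 1 a) (f * monom 1 b)"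
  using assms
proof (induction m)
  case (Suc m)
  have "coeff (f * monom 1 (c + m)) (N - 1) = 0" if "degree f + c + Suc m < N" for c
    using degree_mult_monom_le[of f "c + m"] that by (intro coeff_eq_0) linarith
  then have "order_form N (f * monom 1 (a + Suc m)) (f * monom 1 (b + Suc m)) =
      order_form N (f * monom 1 (a + m)) (f * monom 1 (b + m))"
    using Suc.prems by (simp add: monom_Suc order_form_pCons)
  with Suc show ?case by simp
qed simp

text \<open>Shift invariance says that the Gram matrix of the multiples of f by monomials is
  Toeplitz. The equality of differences is written additively to stay within the naturals.\<close>

lemma order_form_toeplitz:
  assumes "a + b' = a' + b"
    and "degree f + a < N" "degree f + b < N" "degree f + a' < N" "degree f + b' < N"
  shows "order_form N (f * monom 1 a) (f * monom 1 b) = order_form N (f * monom 1 a') (f * monom 1 b')"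
proof (cases "a \<le> a'")
  case True
  then obtain m where "a' = a + m" by (auto simp: le_iff_add)
  moreover from this assms(1) have "b' = b + m" by simp
  ultimately show ?thesis
    using order_form_shift[of f a m N b] assms by simp
next
  case False
  then obtain m where "a = a' + m" by (metis le_iff_add nat_le_linear)
  moreover from this assms(1) have "b = b' + m" by simp
  ultimately show ?thesis
    using order_form_shift[of f a' m N b'] assms by simp
qed

text \<open>Summation by parts: \<^const>\<open>order_sign\<close> turns the difference operator \<open>1 - x\<close> into \<open>-(1 + x)\<close>;
  the assumption removes the boundary term.\<close>

lemma order_form_adjoint:
  assumes "coeff u (N - 1) = 0"
  shows "order_form N p ([:1, -1:] * u) = - (\<Sum>j<N. coeff p j * coeff ([:1, 1:] * u) j)"
proof -
  define d where "d = [:1, -1:] * u"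
  have d: "coeff d j = coeff u j - (case j of 0 \<Rightarrow> 0 | Suc i \<Rightarrow> coeff u i)"
    "coeff ([:1, 1:] * u) j = coeff u j + (case j of 0 \<Rightarrow> 0 | Suc i \<Rightarrow> coeff u i)" for j
    by (simp_all add: d_def coeff_pCons split: nat.splits)
  \<comment> \<open>Multiplication by 1 - x takes differences, so prefix sums recover u. Below, the
    indices before j enter with sign -1 and those after j telescope to the boundary coefficient at M
    - 1.\<close>
  have partial: "(\<Sum>i<Suc j. coeff d i) = coeff u j" for j
    by (induction j) (simp_all add: d)
  have "(\<Sum>i<M. order_sign j i * coeff d i) = coeff u (M - 1) - coeff ([:1, 1:] * u) j"
    if "Suc j \<le> M" for j M
    using that
  proof (induction M rule: dec_induct)
    case base
    have "(\<Sum>i<Suc j. order_sign j i * coeff d i) = - (\<Sum>i<j. coeff d i)"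
      by (simp add: order_sign_def sum_negf)
    also have "(\<Sum>i<j. coeff d i) = coeff u j - coeff d j"
      using partial[of j] by (simp add: algebra_simps)
    also have "- (coeff u j - coeff d j) = coeff u (Suc j - 1) - coeff ([:1, 1:] * u) j"
      by (simp only: d diff_Suc_1) simp
    finally show ?case .
  next
    case (step M)
    then show ?case
      by (cases M) (auto simp: order_sign_def d(1))
  qed
  from this[of _ N] have "order_form N p ([:1, -1:] * u) = (\<Sum>j<N. coeff p j * - coeff ([:1, 1:] * u) j)"
    unfolding order_form_def d_def[symmetric]
    using assms by (simp add: mult.assoc flip: sum_distrib_left)
  then show ?thesis
    by (simp only: mult_minus_right sum_negf)
qed

lemma poly_1_eq_sum:
  fixes p :: "'a::comm_semiring_1 poly"
  shows "degree p < N \<Longrightarrow> poly p 1 = (\<Sum>i<N. coeff p i)"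
  unfolding poly_altdef power_one mult_1_right
  by (rule sum.mono_neutral_left) (auto simp: coeff_eq_0)

text \<open>All indices of p precede N, so every sign is +1. This is the source of the factor f(1)
  for odd n.\<close>

lemma order_form_monom_top:
  assumes "degree p < N"
  shows "order_form (Suc N) p (monom 1 N) = poly p 1"
proof -
  have "(\<Sum>j<Suc N. coeff p i * order_sign i j * coeff (monom 1 N) j) = coeff p i * order_sign i N" for i
    by (simp add: if_distrib[of "\<lambda>x. _ * x"] sum.delta cong: if_cong)
  then have "order_form (Suc N) p (monom 1 N) = (\<Sum>i<Suc N. coeff p i * order_sign i N)"
    by (simp only: order_form_def)
  also have "\<dots> = (\<Sum>i<N. coeff p i)"
    by (simp add: order_sign_def)
  finally show ?thesis
    using assms by (simp add: poly_1_eq_sum)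
qed

text \<open>Both ways of computing the pairing sum of the Gram matrix of h: by change of basis from
  the rows, and by its isotropic half. The constants on either side are left unevaluated.\<close>

lemma minor_sum_isotropic:
  fixes \<rho> h :: "nat \<Rightarrow> 'a::{idom,ring_char_0} poly"
  assumes h: "\<And>a. a < 2 * k \<Longrightarrow> h a = (\<Sum>i<2*k. Polynomial.smult (g a i) (\<rho> i))"
    and iso: "\<And>a b. a < k \<Longrightarrow> b < k \<Longrightarrow> order_form N (h a) (h b) = 0"
  shows "det (mat (2*k) (2*k) (\<lambda>(a, i). g a i)) *
      (minor_sum (2*k) N (\<lambda>i. coeff (\<rho> i)) * pairing_sum k order_sign) =
    det (mat k k (\<lambda>(a, b). order_form N (h a) (h (k + b)))) * pairing_sum k (symplectic k)"
proof -
  have "minor_sum (2*k) N (\<lambda>i. coeff (\<rho> i)) * pairing_sum k order_sign =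
      pairing_sum k (\<lambda>i j. order_form N (\<rho> i) (\<rho> j))"
    by (simp add: pairing_sum_order_sign order_form_def)
  then have "det (mat (2*k) (2*k) (\<lambda>(a, i). g a i)) *
      (minor_sum (2*k) N (\<lambda>i. coeff (\<rho> i)) * pairing_sum k order_sign) =
      pairing_sum k (\<lambda>a b. \<Sum>i<2*k. \<Sum>j<2*k. g a i * order_form N (\<rho> i) (\<rho> j) * g b j)"
    by (simp add: pairing_sum_transform)
  also have "\<dots> = pairing_sum k (\<lambda>a b. order_form N (h a) (h b))"
    by (rule pairing_sum_cong) (simp add: h order_form_sum order_form_smult sum_distrib_left ac_simps, rule sum.swap)
  also have "\<dots> = det (mat k k (\<lambda>(a, b). order_form N (h a) (h (k + b)))) * pairing_sum k (symplectic k)"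
    by (intro pairing_sum_isotropic iso order_form_self order_form_skew)
  finally show ?thesis .
qed

subsection \<open>Constant terms\<close>

text \<open>The autocorrelation of the coefficient sequence of f at lag d.\<close>

definition autocorr :: "'a::field poly \<Rightarrow> int \<Rightarrow> 'a" where
  "autocorr f d = CT (fls_X powi d * fls_eval f fls_X * fls_eval f (inverse fls_X))"

lemma fls_eval_mult_monom: "fls_eval (f * monom 1 a) x = fls_eval f x * x ^ a"
  by (induction a) (simp_all add: monom_Suc fls_eval_def map_poly_pCons ac_simps one_pCons)

text \<open>Only the products of x^j with x^(-j) reach the constant term.\<close>

lemma CT_fls_eval_mult:
  assumes "degree q < N"
  shows "CT (fls_eval p fls_X * fls_eval q (inverse fls_X)) = (\<Sum>j<N. coeff p j * coeff q j)"
proof -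
  let ?P = "fls_eval p fls_X"
  have deg: "degree (map_poly fls_const q) = degree q"
    by (rule degree_map_poly) simp
  have "?P * fls_eval q (inverse fls_X) = (\<Sum>j\<le>degree q. fls_const (coeff q j) * (?P / fls_X ^ j))"
    unfolding fls_eval_def[of q] poly_altdef deg sum_distrib_left
    by (simp only: coeff_map_poly fls_const_0 divide_inverse power_inverse ac_simps)
  moreover have "fls_nth ?P (int j) = coeff p j" for j
    by (simp add: fls_eval_X)
  ultimately have "CT (?P * fls_eval q (inverse fls_X)) = (\<Sum>j\<le>degree q. coeff q j * coeff p j)"
    by (simp add: CT_def fls_nth_sum fls_divide_X_power)
  also have "\<dots> = (\<Sum>j<N. coeff p j * coeff q j)"
    using assms by (intro sum.mono_neutral_cong_left) (auto simp: coeff_eq_0)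
  finally show ?thesis .
qed

lemma sum_coeff_shifts:
  assumes "degree f + b < N"
  shows "(\<Sum>j<N. coeff (f * monom 1 a) j * coeff (f * monom 1 b) j) = autocorr f (int a - int b)"
proof -
  have powi: "y powi (int a - int b) = y ^ a * inverse y ^ b" if "y \<noteq> 0" for y :: "'a fls"
    using that by (simp add: power_int_diff power_inverse divide_inverse)
  have "(\<Sum>j<N. coeff (f * monom 1 a) j * coeff (f * monom 1 b) j) =
      CT (fls_eval (f * monom 1 a) fls_X * fls_eval (f * monom 1 b) (inverse fls_X))"
    using degree_mult_monom_le[of f b] assms by (intro CT_fls_eval_mult[symmetric]) linarith
  also have "fls_eval (f * monom 1 a) fls_X * fls_eval (f * monom 1 b) (inverse fls_X) =
      fls_X powi (int a - int b) * fls_eval f fls_X * fls_eval f (inverse fls_X)"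
    by (simp only: fls_eval_mult_monom powi[OF fls_X_nonzero] ac_simps)
  finally show ?thesis
    by (simp add: autocorr_def)
qed

text \<open>As a scalar product of two shifts of f, the autocorrelation is symmetric in these
  shifts.\<close>

lemma autocorr_minus: "autocorr f (- d) = autocorr f d"
proof -
  obtain a b where d: "d = int a - int b"
    using int_diff_cases by blast
  let ?N = "degree f + a + b + 1"
  have "autocorr f (int b - int a) = autocorr f (int a - int b)"
    using sum_coeff_shifts[of f a ?N b] sum_coeff_shifts[of f b ?N a] by (simp add: mult.commute)
  then show ?thesis by (simp add: d)
qed

lemma autocorr_1: "autocorr 1 d = (if d = 0 then 1 else 0)"
proof -
  have "fls_eval 1 x = 1" for x :: "'a fls"
    by (simp add: fls_eval_def)
  moreover have "CT (fls_X powi d :: 'a fls) = (if d = 0 then 1 else 0)"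
    by (cases "d \<ge> 0") (auto simp: CT_def power_int_def fls_inverse_X simp flip: power_inverse)
  ultimately show ?thesis
    by (simp add: autocorr_def)
qed

section \<open>The matrix M, the reference case f = 1, and powers of 1 + x\<close>

lemma sum_maximal_minors_M_mat:
  "sum_maximal_minors (M_mat n f) = minor_sum n (degree f + n) (\<lambda>i. coeff (f * [:1, 1:] ^ i))"
proof -
  have dim: "dim_row (M_mat n f) = n" "dim_col (M_mat n f) = degree f + n"
    by (simp_all add: M_mat_def mat1_def)
  have "submatrix (M_mat n f) {..<n} J = mat n n (\<lambda>(i, m). coeff (f * [:1, 1:] ^ i) (pick J m))"
    if J: "J \<subseteq> {..<degree f + n}" "card J = n" for J
  proof -
    have "{i. i < n \<and> i \<in> {..<n}} = {..<n}" "{j. j < degree f + n \<and> j \<in> J} = J"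
      using J by auto
    then have "submatrix (M_mat n f) {..<n} J = mat n n (\<lambda>(i, j). M_mat n f $$ (pick {..<n} i, pick J j))"
      unfolding submatrix_def dim using J by simp
    also have "\<dots> = mat n n (\<lambda>(i, m). coeff (f * [:1, 1:] ^ i) (pick J m))"
    proof (rule eq_matI; simp)
      fix i m assume "i < n" "m < n"
      moreover from this have "pick J m < degree f + n"
        using pick_in_set_le[of m J] J by auto
      ultimately show "M_mat n f $$ (pick {..<n} i, pick J m) = coeff (f * [:1, 1:] ^ i) (pick J m)"
        by (simp add: pick_lessThan M_mat_entry)
    qed
    finally show ?thesis .
  qed
  then show ?thesis
    by (simp add: sum_maximal_minors_def minor_sum_def dim)
qed

text \<open>For f = 1 the matrix is square, and its only maximal minor is that of the unitriangular
  matrix of binomial coefficients.\<close>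

lemma minor_sum_1: "minor_sum n n (\<lambda>i. coeff ([:1, 1:] ^ i)) = (1 :: 'a::comm_ring_1)"
proof -
  let ?A = "mat n n (\<lambda>(i, m). coeff ([:1, 1::'a:] ^ i) m)"
  have "{I. I \<subseteq> {..<n} \<and> card I = n} = {{..<n}}"
    using card_subset_eq[of "{..<n}"] by auto
  moreover have "mat n n (\<lambda>(i, m). coeff ([:1, 1::'a:] ^ i) (pick {..<n} m)) = ?A"
    by (rule eq_matI) (auto simp: pick_lessThan)
  moreover have "det ?A = prod_list (diag_mat ?A)"
    by (rule det_lower_triangular[of n]) (auto simp: coeff_eq_0 degree_linear_power)
  moreover have "diag_mat ?A = map (\<lambda>i. 1) [0..<n]"
    by (auto simp: diag_mat_def coeff_linear_power)
  ultimately show ?thesis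
    by (simp add: minor_sum_def prod_list_replicate map_replicate_const)
qed

text \<open>Substitute x - 1 for x, expand in monomials, and substitute back.\<close>

lemma shifted_basis_expansion:
  fixes h :: "'a::{comm_ring_1,semiring_no_zero_divisors} poly"
  assumes "degree h < n"
  shows "h = (\<Sum>i<n. Polynomial.smult (coeff (pcompose h [:-1, 1:]) i) ([:1, 1:] ^ i))"
proof -
  let ?P = "pcompose h [:-1, 1:]"
  have monom: "pcompose (monom c i) q = Polynomial.smult c (q ^ i)" for c :: 'a and i q
    by (induction i) (simp_all add: monom_0 monom_Suc pcompose_pCons)
  have "degree ?P \<le> n - 1"
    using assms by (simp add: degree_pcompose)
  then have "(\<Sum>i<n. monom (coeff ?P i) i) = ?P"
    using poly_as_sum_of_monoms'[of ?P "n - 1"] assms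
    by (cases n) (simp_all add: lessThan_Suc_atMost)
  then have "(\<Sum>i<n. Polynomial.smult (coeff ?P i) ([:1, 1:] ^ i)) = pcompose ?P [:1, 1:]"
    by (metis (no_types, lifting) monom pcompose_sum sum.cong)
  also have "\<dots> = h"
    by (simp add: pcompose_pCons flip: pcompose_assoc)
  finally show ?thesis by simp
qed

subsection \<open>Evaluation of the sum of minors\<close>

text \<open>Reflecting the exponents reverses differences. By the Toeplitz property and skewness,
  each of the four monomial pairings therefore cancels against its reflection. The cases e = 1 and e
  = -1 are the palindromic and antipalindromic ones.\<close>

lemma order_form_palindromic:
  fixes f :: "'a::{idom,ring_char_0} poly"
  assumes ab: "a + a' = b + b'" and e: "e * e = 1"
    and N: "degree f + a < N" "degree f + a' < N" "degree f + b < N" "degree f + b' < N"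
  shows "order_form N (f * (monom 1 a + monom e a')) (f * (monom 1 b + monom e b')) = 0"
proof -
  have monom: "f * monom e c = Polynomial.smult e (f * monom 1 c)" for c
    by (simp add: smult_monom flip: mult_smult_right)
  have "order_form N (f * monom 1 a') (f * monom 1 b') = - order_form N (f * monom 1 a) (f * monom 1 b)"
    using order_form_toeplitz[of a' a b b' f N] order_form_skew[of N "f * monom 1 a" "f * monom 1 b"] ab N
    by simp
  moreover have "order_form N (f * monom 1 a') (f * monom 1 b) = - order_form N (f * monom 1 a) (f * monom 1 b')"
    using order_form_toeplitz[of a' a b' b f N] order_form_skew[of N "f * monom 1 a" "f * monom 1 b'"] ab N
    by simp
  moreover have "e * (e * x) = x" for x
    by (simp add: e flip: mult.assoc)
  ultimately show ?thesis
    by (simp add: distrib_left monom order_form_add order_form_smult right_diff_distrib)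
qed

text \<open>The same four terms as for the order form, but the scalar product is symmetric:
  reflected terms agree, whence the factor 2.\<close>

lemma sum_coeff_palindromic:
  fixes f :: "'a::field poly"
  assumes ab: "a + a' = b + b'" and e: "e * e = 1"
    and N: "degree f + b < N" "degree f + b' < N"
  shows "(\<Sum>j<N. coeff (f * (monom 1 a + monom e a')) j * coeff (f * (monom 1 b + monom e b')) j) =
    2 * (autocorr f (int a - int b) + e * autocorr f (int a - int b'))"
proof -
  have monom: "f * monom e c = Polynomial.smult e (f * monom 1 c)" for c
    by (simp add: smult_monom flip: mult_smult_right)
  let ?c = "\<lambda>x y. \<Sum>j<N. coeff (f * monom 1 x) j * coeff (f * monom 1 y) j"
  have "(\<Sum>j<N. coeff (f * (monom 1 a + monom e a')) j * coeff (f * (monom 1 b + monom e b')) j) =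
      ?c a b + e * ?c a b' + e * ?c a' b + e * e * ?c a' b'"
    by (simp add: distrib_left monom algebra_simps sum.distrib sum_distrib_left)
  also have "\<dots> = autocorr f (int a - int b) + e * autocorr f (int a - int b') +
      e * autocorr f (int a' - int b) + autocorr f (int a' - int b')"
    using N by (simp add: sum_coeff_shifts e)
  also have "int a' - int b = - (int a - int b')"
    using ab by simp
  also have "int a' - int b' = - (int a - int b)"
    using ab by simp
  finally show ?thesis
    by (simp only: autocorr_minus) (simp add: algebra_simps)
qed

lemma degree_linear_cofactor:
  fixes u :: "'a::idom poly"
  assumes "degree ([:1, 1:] * u) < n" "n > 1"
  shows "degree u + 1 < n"
  using assms by (cases "u = 0") (simp_all add: degree_mult_eq del: mult_pCons_left)

text \<open>Here \<open>h\<close> is a basis of the polynomials of degree below \<open>2 * k\<close>: the palindromic \<open>s i\<close>, followed by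
  \<open>s i * (1 - x) / (1 + x)\<close>. The change of basis \<open>g\<close> to the powers of \<open>1 + x\<close> does not depend on \<open>f\<close>.\<close>

lemma minor_sum_even:
  fixes f :: "'a::field_char_0 poly"
  shows "minor_sum (2 * k) (degree f + 2 * k) (\<lambda>i. coeff (f * [:1, 1:] ^ i)) =
    det (mat k k (\<lambda>(i, j). autocorr f (int i + int j + 1) + autocorr f (int i - int j)))"
proof -
  define s where "s i = monom 1 (k + i) + monom (1::'a) (k - 1 - i)" for i
  define u where "u i = s i div [:1, 1:]" for i
  define h where "h a = (if a < k then s a else [:1, -1:] * u (a - k))" for a
  define g where "g a i = coeff (pcompose (h a) [:-1, 1:]) i" for a i
  let ?S = "\<lambda>f. minor_sum (2 * k) (degree f + 2 * k) (\<lambda>i. coeff (f * [:1, 1:] ^ i))"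
  let ?T = "\<lambda>f. mat k k (\<lambda>(i, j). autocorr f (int i + int j + 1) + autocorr f (int i - int j))"
  let ?C = "pairing_sum k order_sign :: 'a" and ?P = "pairing_sum k (symplectic k) :: 'a"
  let ?G = "det (mat (2*k) (2*k) (\<lambda>(a, i). g a i))"
  \<comment> \<open>The two exponents of \<open>s i\<close> have opposite parity, so -1 is a root
    and the division by 1 + x is exact.\<close>
  have su: "[:1, 1:] * u i = s i" if "i < k" for i
  proof -
    have "k + i = (k - 1 - i) + (2 * i + 1)"
      using that by simp
    then have "(-1::'a) ^ (k + i) = (-1) ^ (k - 1 - i) * (-1) ^ (2 * i + 1)"
      by (metis power_add)
    then have "poly (s i) (-1) = 0"
      by (simp add: s_def poly_monom)
    then show ?thesis
      by (simp add: u_def poly_eq_0_iff_dvd del: mult_pCons_left)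
  qed
  have deg_s: "degree (s i) < 2 * k" if "i < k" for i
    unfolding s_def by (rule degree_add_less) (use that in \<open>auto simp: degree_monom_eq\<close>)
  have deg_u: "degree (u i) + 1 < 2 * k" if "i < k" for i
    using degree_linear_cofactor[of "u i" "2 * k"] su[OF that] deg_s[OF that] that by simp
  have deg_h: "degree (h a) < 2 * k" if "a < 2 * k" for a
  proof (cases "a < k")
    case False
    then have "degree (u (a - k)) + 1 < 2 * k"
      using that by (intro deg_u) simp
    with False show ?thesis
      using degree_mult_le[of "[:1, -1:]" "u (a - k)"] by (simp add: h_def del: mult_pCons_left)
  qed (simp add: h_def deg_s)
  have key: "?G * (?S f * ?C) = (- 2) ^ k * det (?T f) * ?P" for f
  proof -
    let ?N = "degree f + 2 * k"
    have "?G * (?S f * ?C) =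
        det (mat k k (\<lambda>(a, b). order_form ?N (f * h a) (f * h (k + b)))) * ?P"
    proof (rule minor_sum_isotropic)
      show "f * h a = (\<Sum>i<2*k. Polynomial.smult (g a i) (f * [:1, 1:] ^ i))" if "a < 2 * k" for a
        by (subst shifted_basis_expansion[OF deg_h[OF that]]) (simp add: g_def sum_distrib_left)
      show "order_form ?N (f * h a) (f * h b) = 0" if "a < k" "b < k" for a b
        using that unfolding h_def s_def by (simp, intro order_form_palindromic) auto
    qed
    \<comment> \<open>Summation by parts trades 1 - x for -(1 + x), which turns \<open>u b\<close>
      back into \<open>s b\<close>. The factor -2 combines this sign with the doubling for
      palindromes.\<close>
    also have "mat k k (\<lambda>(a, b). order_form ?N (f * h a) (f * h (k + b))) = (- 2) \<cdot>\<^sub>m ?T f"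
    proof (rule eq_matI)
      fix a b assume "a < dim_row ((- 2) \<cdot>\<^sub>m ?T f)" "b < dim_col ((- 2) \<cdot>\<^sub>m ?T f)"
      then have ab: "a < k" "b < k" by auto
      have "degree (f * u b) < ?N - 1"
        using degree_mult_le[of f "u b"] deg_u[OF ab(2)] by linarith
      then have "order_form ?N (f * s a) ([:1, -1:] * (f * u b)) =
          - (\<Sum>j<?N. coeff (f * s a) j * coeff ([:1, 1:] * (f * u b)) j)"
        by (intro order_form_adjoint coeff_eq_0)
      also have "[:1, 1:] * (f * u b) = f * s b"
        using su[OF ab(2)] by (metis mult.left_commute)
      also have "(\<Sum>j<?N. coeff (f * s a) j * coeff (f * s b) j) =
          2 * (autocorr f (int (k + a) - int (k + b)) + 1 * autocorr f (int (k + a) - int (k - 1 - b)))"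
        unfolding s_def using ab by (intro sum_coeff_palindromic) auto
      also have "int (k + a) - int (k - 1 - b) = int a + int b + 1"
        using ab by simp
      finally have val: "order_form ?N (f * s a) ([:1, -1:] * (f * u b)) =
          - 2 * (autocorr f (int a + int b + 1) + autocorr f (int a - int b))"
        by simp
      have hb: "f * h (k + b) = [:1, -1:] * (f * u b)"
        unfolding h_def by (simp only: mult.left_commute) simp
      show "mat k k (\<lambda>(a, b). order_form ?N (f * h a) (f * h (k + b))) $$ (a, b) =
          ((- 2) \<cdot>\<^sub>m ?T f) $$ (a, b)"
        using ab val[folded hb] by (simp add: h_def[of a])
    qed auto
    finally show ?thesis
      by simp
  qed
  \<comment> \<open>The case f = 1 expresses the unknown product \<open>?G * ?C\<close> by a nonzero
    constant, which then cancels for general f.\<close>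
  have "?T (1 :: 'a poly) = 1\<^sub>m k"
    by (rule eq_matI) (auto simp: autocorr_1)
  then have GC: "?G * ?C = (- 2) ^ k * ?P"
    using key[of 1] by (simp add: minor_sum_1)
  have "(- 2) ^ k * ?P * ?S f = ?G * ?C * ?S f"
    by (simp only: GC)
  also have "\<dots> = (- 2) ^ k * ?P * det (?T f)"
    using key[of f] by (simp only: ac_simps)
  finally show ?thesis
    using pairing_sum_symplectic_nonzero[where 'a = 'a] by simp
qed

text \<open>The matrix is bordered by one row, the monomial \<open>x ^ (degree f + n)\<close>, which pairs with \<open>p\<close> to
  \<open>p(1)\<close>. The isotropic half consists of this row and the antipalindromic \<open>s i\<close>; it is
  complemented by \<open>s i * (1 - x) / (1 + x)\<close> and \<open>x ^ k\<close>.\<close>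

lemma minor_sum_odd:
  fixes f :: "'a::field_char_0 poly"
  shows "minor_sum (2 * k + 1) (degree f + (2 * k + 1)) (\<lambda>i. coeff (f * [:1, 1:] ^ i)) =
    poly f 1 * det (mat k k (\<lambda>(i, j). autocorr f (int i - int j) - autocorr f (int i + int j + 2)))"
proof -
  define n where "n = 2 * k + 1"
  define K where "K = Suc k"
  \<comment> \<open>The exponents add up to 2k and have equal parity, so with the minus sign both 1
    and -1 are roots. The root -1 permits division by 1 + x; the root 1 gives orthogonality to the
    bordering row.\<close>
  define s where "s i = monom 1 (k + 1 + i) + monom (- 1::'a) (k - 1 - i)" for i
  define u where "u i = s i div [:1, 1:]" for i
  \<comment> \<open>Index k is reserved for the bordering monomial, which \<open>g\<close> and
    \<open>H\<close> supply. The isotropic half thus has k + 1 members, and its complement starts at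
    \<open>K\<close>.\<close>
  define h where "h a = (if a < k then s a else if a < 2 * k + 1 then [:1, -1:] * u (a - K) else monom 1 k)" for a
  define g where "g a i = (if a = k then if i = n then 1 else 0
    else if i < n then coeff (pcompose (h a) [:-1, 1:]) i else 0)" for a i
  define \<rho> where "\<rho> f i = (if i < n then f * [:1, 1:] ^ i else monom 1 (degree f + n))" for f :: "'a poly" and i
  define H where "H f a = (if a = k then monom 1 (degree f + n) else f * h a)" for f a
  let ?S = "\<lambda>f. minor_sum n (degree f + n) (\<lambda>i. coeff (f * [:1, 1:] ^ i))"
  let ?T = "\<lambda>f. mat k k (\<lambda>(i, j). autocorr f (int i - int j) - autocorr f (int i + int j + 2))"
  let ?C = "pairing_sum K order_sign :: 'a" and ?P = "pairing_sum K (symplectic K) :: 'a"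
  let ?G = "det (mat (2*K) (2*K) (\<lambda>(a, i). g a i))"
  have K: "2 * K = Suc n" by (simp add: K_def n_def)
  have su: "[:1, 1:] * u i = s i" if "i < k" for i
  proof -
    have "k + 1 + i = (k - 1 - i) + 2 * (i + 1)"
      using that by simp
    then have "(-1::'a) ^ (k + 1 + i) = (-1) ^ (k - 1 - i) * (-1) ^ (2 * (i + 1))"
      by (metis power_add)
    then have "poly (s i) (-1) = 0"
      by (simp add: s_def poly_monom)
    then show ?thesis
      by (simp add: u_def poly_eq_0_iff_dvd del: mult_pCons_left)
  qed
  have s1: "poly (s i) 1 = 0" for i
    by (simp add: s_def poly_monom)
  have deg_s: "degree (s i) < n" if "i < k" for i
    unfolding s_def n_def by (rule degree_add_less) (use that in \<open>auto simp: degree_monom_eq\<close>)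
  have deg_u: "degree (u i) + 1 < n" if "i < k" for i
    using degree_linear_cofactor[of "u i" n] su[OF that] deg_s[OF that] that by (simp add: n_def)
  have deg_h: "degree (h a) < n" if "a < 2 * K" "a \<noteq> k" for a
  proof -
    have "a < k \<or> K \<le> a \<and> a < n \<or> a = n"
      using that unfolding K_def n_def by arith
    then consider "a < k" | "K \<le> a" "a < n" | "a = n"
      by blast
    then show ?thesis
    proof cases
      case 2
      then have "degree (u (a - K)) + 1 < n"
        by (intro deg_u) (auto simp: K_def n_def)
      with 2 show ?thesis
        using degree_mult_le[of "[:1, -1:]" "u (a - K)"]
        by (simp add: h_def K_def n_def del: mult_pCons_left)
    qed (use deg_s in \<open>simp_all add: h_def n_def degree_monom_eq\<close>)
  qed
  have deg_fh: "degree (f * h a) < degree f + n" if "a < 2 * K" "a \<noteq> k" for f a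
    using degree_mult_le[of f "h a"] deg_h[OF that] by linarith
  have key: "?G * (?S f * ?C) = (- 2) ^ k * det (?T f) * - poly f 1 * ?P" for f
  proof -
    let ?N = "degree f + n"
    have "?S f = minor_sum n ?N (\<lambda>i. coeff (\<rho> f i))"
      by (auto simp: minor_sum_def \<rho>_def intro!: sum.cong arg_cong[of _ _ det] eq_matI)
    also have "\<dots> = minor_sum (2 * K) (Suc ?N) (\<lambda>i. coeff (\<rho> f i))"
      unfolding K by (rule minor_sum_border[symmetric]) (simp add: \<rho>_def)
    finally have "?G * (?S f * ?C) = ?G * (minor_sum (2 * K) (Suc ?N) (\<lambda>i. coeff (\<rho> f i)) * ?C)"
      by simp
    also have "\<dots> = det (mat K K (\<lambda>(a, b). order_form (Suc ?N) (H f a) (H f (K + b)))) * ?P"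
    proof (rule minor_sum_isotropic)
      show "H f a = (\<Sum>i<2*K. Polynomial.smult (g a i) (\<rho> f i))" if a: "a < 2 * K" for a
      proof (cases "a = k")
        case True
        then have "(\<Sum>i<2*K. Polynomial.smult (g a i) (\<rho> f i)) = (\<Sum>i<2*K. if i = n then monom 1 ?N else 0)"
          by (intro sum.cong) (auto simp: g_def \<rho>_def)
        then show ?thesis
          using True K by (simp add: H_def)
      next
        case False
        have "(\<Sum>i<2*K. Polynomial.smult (g a i) (\<rho> f i)) =
            f * (\<Sum>i<n. Polynomial.smult (coeff (pcompose (h a) [:-1, 1:]) i) ([:1, 1:] ^ i))"
          unfolding K using False by (simp add: g_def \<rho>_def sum_distrib_left)
        also have "\<dots> = f * h a"
          using shifted_basis_expansion[OF deg_h[OF a False]] by simp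
        finally show ?thesis
          using False by (simp add: H_def)
      qed
      \<comment> \<open>The pairing with the bordering monomial evaluates at 1, where
        \<open>s a\<close> vanishes.\<close>
      have mixed: "order_form (Suc ?N) (H f a) (H f k) = 0" if "a < k" for a
        using that deg_fh[of a f] s1 by (simp add: H_def order_form_monom_top K_def) (simp add: h_def)
      show "order_form (Suc ?N) (H f a) (H f b) = 0" if ab: "a < K" "b < K" for a b
      proof -
        consider "a = k" "b = k" | "a < k" "b = k" | "a = k" "b < k" | "a < k" "b < k"
          using ab unfolding K_def less_Suc_eq by blast
        then show ?thesis
        proof cases
          case 3
          then show ?thesis
            using mixed[of b] order_form_skew[of "Suc ?N" "H f k" "H f b"] by simp
        next
          case 4
          then show ?thesis
            unfolding H_def h_def s_def by (simp, intro order_form_palindromic) (auto simp: n_def)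
        qed (simp_all add: order_form_self mixed)
      qed
    qed
    \<comment> \<open>The last row again evaluates at 1: the factor 1 - x gives zeros, and only the
      multiple of x^k survives, contributing -f(1). The block triangular shape then splits the
      determinant.\<close>
    also have "mat K K (\<lambda>(a, b). order_form (Suc ?N) (H f a) (H f (K + b))) =
      four_block_mat ((- 2) \<cdot>\<^sub>m ?T f) (mat k 1 (\<lambda>(a, b). order_form (Suc ?N) (f * s a) (f * monom 1 k)))
        (0\<^sub>m 1 k) (mat 1 1 (\<lambda>_. - poly f 1))" (is "?A = ?B")
    proof (rule eq_matI)
      fix a b assume "a < dim_row ?B" "b < dim_col ?B"
      then have ab: "a \<le> k" "b \<le> k" by auto
      have h1: "poly (h (K + b)) 1 = (if b < k then 0 else 1)"
        using ab by (simp add: h_def K_def poly_monom)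
      have last: "order_form (Suc ?N) (monom 1 ?N) (f * h (K + b)) = - poly (f * h (K + b)) 1"
        using order_form_skew[of "Suc ?N" "monom 1 ?N" "f * h (K + b)"]
          deg_fh[of "K + b" f] ab by (simp add: order_form_monom_top K_def)
      consider "a < k" "b < k" | "a < k" "b = k" | "a = k"
        using ab by linarith
      then show "?A $$ (a, b) = ?B $$ (a, b)"
      proof cases
        case 1
        have "degree (f * u b) < Suc ?N - 1"
          using degree_mult_le[of f "u b"] deg_u[OF 1(2)] by linarith
        then have "order_form (Suc ?N) (f * s a) ([:1, -1:] * (f * u b)) =
            - (\<Sum>j<Suc ?N. coeff (f * s a) j * coeff ([:1, 1:] * (f * u b)) j)"
          by (intro order_form_adjoint coeff_eq_0)
        also have "[:1, 1:] * (f * u b) = f * s b"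
          using su[OF 1(2)] by (metis mult.left_commute)
        also have "(\<Sum>j<Suc ?N. coeff (f * s a) j * coeff (f * s b) j) =
            2 * (autocorr f (int (k + 1 + a) - int (k + 1 + b)) +
              - 1 * autocorr f (int (k + 1 + a) - int (k - 1 - b)))"
          unfolding s_def using 1 by (intro sum_coeff_palindromic) (auto simp: n_def)
        also have "int (k + 1 + a) - int (k - 1 - b) = int a + int b + 2"
          using 1 by simp
        finally have val: "order_form (Suc ?N) (f * s a) ([:1, -1:] * (f * u b)) =
            - 2 * (autocorr f (int a - int b) - autocorr f (int a + int b + 2))"
          by simp
        have hb: "f * h (K + b) = [:1, -1:] * (f * u b)"
          unfolding h_def K_def using 1 by (simp only: mult.left_commute) simp
        show ?thesis
          using 1 val[folded hb] by (simp add: H_def K_def h_def[of a])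
      next
        case 2
        then show ?thesis
          by (simp add: H_def K_def h_def)
      next
        case 3
        then show ?thesis
          using h1 last ab by (auto simp: H_def K_def)
      qed
    qed (auto simp: K_def)
    also have "det ?B = det ((- 2) \<cdot>\<^sub>m ?T f) * det (mat 1 1 (\<lambda>_. - poly f 1))"
      by (rule det_four_block_mat_lower_left_zero) auto
    also have "det (mat 1 1 (\<lambda>_. - poly f 1)) = - poly f 1"
      by (simp add: det_single)
    finally show ?thesis
      by simp
  qed
  \<comment> \<open>Here f(1) = 1 as well, so the constant differs from the even case by the sign
    from the corner entry.\<close>
  have "?T (1 :: 'a poly) = 1\<^sub>m k"
    by (rule eq_matI) (auto simp: autocorr_1)
  then have GC: "?G * ?C = - ((- 2) ^ k * ?P)"
    using key[of 1] by (simp add: minor_sum_1)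
  have "- ((- 2) ^ k * ?P) * ?S f = ?G * ?C * ?S f"
    by (simp only: GC)
  also have "\<dots> = - ((- 2) ^ k * ?P) * (poly f 1 * det (?T f))"
    using key[of f] by (simp add: ac_simps)
  finally show ?thesis
    using pairing_sum_symplectic_nonzero[of K, where 'a = 'a] by (simp add: n_def)
qed

theorem theorem9:
  fixes f :: "rat poly" and n k :: nat
  assumes "n \<ge> 1"
  shows "(n = 2 * k \<longrightarrow>
            sum_maximal_minors (M_mat n f) =
              det (mat1 k k (\<lambda>i j.
                CT ((fls_X powi (int i + int j - 1) + fls_X powi (int i - int j))
                    * fls_eval f fls_X * fls_eval f (inverse fls_X)))))
       \<and> (n = 2 * k + 1 \<longrightarrow>
            sum_maximal_minors (M_mat n f) =
              poly f 1 * det (mat1 k k (\<lambda>i j.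
                CT ((fls_X powi (int i - int j) - fls_X powi (int i + int j))
                    * fls_eval f fls_X * fls_eval f (inverse fls_X)))))"
proof -
  have CT_add: "CT ((x + y) * F * F') = CT (x * F * F') + CT (y * F * F')"
    and CT_diff: "CT ((x - y) * F * F') = CT (x * F * F') - CT (y * F * F')" for x y F F' :: "rat fls"
    by (simp_all add: CT_def distrib_right left_diff_distrib)
  \<comment> \<open>Passing from 1-based to 0-based indices adds 2 to i + j and leaves i - j
    unchanged.\<close>
  have "mat k k (\<lambda>(i, j). autocorr f (int i + int j + 1) + autocorr f (int i - int j)) =
      mat1 k k (\<lambda>i j. CT ((fls_X powi (int i + int j - 1) + fls_X powi (int i - int j))
        * fls_eval f fls_X * fls_eval f (inverse fls_X)))"
    unfolding mat1_def autocorr_def by (rule eq_matI) (simp_all add: CT_add)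
  moreover have "mat k k (\<lambda>(i, j). autocorr f (int i - int j) - autocorr f (int i + int j + 2)) =
      mat1 k k (\<lambda>i j. CT ((fls_X powi (int i - int j) - fls_X powi (int i + int j))
        * fls_eval f fls_X * fls_eval f (inverse fls_X)))"
    unfolding mat1_def autocorr_def by (rule eq_matI) (simp_all add: CT_diff)
  ultimately show ?thesis
    using minor_sum_even[of k f] minor_sum_odd[of k f] by (simp add: sum_maximal_minors_M_mat)
qed

end
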